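(* Let $M\ge1$ be the number of users, fix a user $k\in\{1,\dots,M\}$ with normalized aperture $W_k>0$, and let $K_k^*=2\lceil W_k\rceil+1$, $\bar\gamma>0$ and $\gamma_{\mathrm{th}}>0$. Under the EDoF model, the outage probability $P_{\mathrm{out},k}^{\mathrm{FAMA}}=\mathbb P(\gamma_k\le\gamma_{\mathrm{th}})$ of user $k$ in an $M$-user FAMA system is $$P_{\mathrm{out},k}^{\mathrm{FAMA}}=\sum_{j=0}^{K_k^*}\binom{K_k^*}{j}\frac{(-1)^j\,e^{-j\gamma_{\mathrm{th}}/\bar\gamma}}{(1+j\gamma_{\mathrm{th}})^{M-1}}.$$
   Context: FAMA stands for fluid antenna multiple access. Under the EDoF (equivalent degrees of freedom) model, the signal-to-interference-plus-noise ratio of user $k$ is $$\gamma_k=\frac{\bar\gamma\,X_{\max,k}}{1+\bar\gamma\sum_{j\ne k}Y_j},$$ where $X_{\max,k}$ is the maximum of $K_k^*$ i.i.d. $\mathrm{Exp}(1)$ random variables (desired signal), the interference gains $Y_j\sim\mathrm{Exp}(1)$ for $j\in\{1,\dots,M\}\setminus\{k\}$ are i.i.d. and independent of $X_{\max,k}$, $\bar\gamma$ is the per-user transmit SNR, and $\gamma_{\mathrm{th}}$ is the outage threshold. *)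

theory Defs
  imports "HOL-Probability.Probability"
begin

text \<open>Equivalent degrees of freedom as a function of the normalized aperture; the integer under
  \<open>nat\<close> is at least \<open>3\<close> for \<open>W > 0\<close>, so no truncation occurs.\<close>

definition edof :: "real \<Rightarrow> nat" where
  "edof W = nat (2 * \<lceil>W\<rceil> + 1)"

definition X_max :: "nat \<Rightarrow> (nat \<Rightarrow> 'w \<Rightarrow> real) \<Rightarrow> 'w \<Rightarrow> real" where
  "X_max K X \<omega> = (MAX i\<in>{1..K}. X i \<omega>)"

definition interferers :: "nat \<Rightarrow> nat \<Rightarrow> nat set" where
  "interferers M k = {1..M} - {k}"

definition fama_sinr ::
  "nat \<Rightarrow> nat \<Rightarrow> nat \<Rightarrow> real \<Rightarrow> (nat \<Rightarrow> 'w \<Rightarrow> real) \<Rightarrow> (nat \<Rightarrow> 'w \<Rightarrow> real) \<Rightarrow> 'w \<Rightarrow> real" where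
  "fama_sinr M k K snr X Y \<omega> =
     snr * X_max K X \<omega> / (1 + snr * (\<Sum>j\<in>interferers M k. Y j \<omega>))"

text \<open>\<open>X i\<close> are the desired-signal gains of user \<open>k\<close>, \<open>Y j\<close> the interference gains it sees.
  The gain \<open>Y k\<close> of the user itself is never used, so slot \<open>k\<close> is taken by \<open>X_max\<close>: for
  \<open>k \<in> {1..M}\<close>, independence of \<open>Y(k := X_max K X)\<close> over \<open>{1..M}\<close> says that the \<open>Y j\<close> with
  \<open>j \<noteq> k\<close> are mutually independent and that, as a family, they are independent of \<open>X_max K X\<close>.\<close>

definition edof_model ::
  "'w measure \<Rightarrow> nat \<Rightarrow> nat \<Rightarrow> nat \<Rightarrow> (nat \<Rightarrow> 'w \<Rightarrow> real) \<Rightarrow> (nat \<Rightarrow> 'w \<Rightarrow> real) \<Rightarrow> bool" where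
  "edof_model P M k K X Y \<longleftrightarrow>
     prob_space P \<and>
     (\<forall>i\<in>{1..K}. distributed P lborel (X i) (exponential_density 1)) \<and>
     prob_space.indep_vars P (\<lambda>_. borel) X {1..K} \<and>
     (\<forall>j\<in>interferers M k. distributed P lborel (Y j) (exponential_density 1)) \<and>
     prob_space.indep_vars P (\<lambda>_. borel) (Y(k := X_max K X)) {1..M}"

definition fama_outage ::
  "'w measure \<Rightarrow> nat \<Rightarrow> nat \<Rightarrow> nat \<Rightarrow> real \<Rightarrow> real \<Rightarrow>
     (nat \<Rightarrow> 'w \<Rightarrow> real) \<Rightarrow> (nat \<Rightarrow> 'w \<Rightarrow> real) \<Rightarrow> real" where
  "fama_outage P M k K snr \<gamma>th X Y =
     measure P {\<omega> \<in> space P. fama_sinr M k K snr X Y \<omega> \<le> \<gamma>th}"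

end

theory Submission
  imports Defs
begin

text \<open>Writing \<open>V\<close> for the maximum and \<open>S\<close> for the total interference, outage means
  \<open>V \<le> \<gamma>th * (1 / snr + S)\<close>. Conditioning on \<open>S\<close> gives the expectation of
  \<open>(1 - exp (- \<gamma>th * (1 / snr + S))) ^ K\<close>; the binomial theorem turns it into a combination of values
  of the Laplace transform of \<open>S\<close> at \<open>j * \<gamma>th\<close>, each of which factors over the interferers.\<close>

lemma (in finite_borel_measure) borel_measurable_cdf: "cdf M \<in> borel_measurable borel"
  by (intro borel_measurable_mono) (auto simp: mono_def intro: cdf_nondecreasing)

context prob_space
begin

text \<open>The density vanishes on the negative half-line. This sign information bounds the
  exponentials below by \<open>1\<close> and keeps the SINR denominator positive.\<close>

lemma exponential_distributed_AE_nonneg: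
  assumes D: "distributed M lborel X (exponential_density l)"
  shows "AE \<omega> in M. 0 \<le> X \<omega>"
proof -
  have "AE \<omega> in M. 0 \<le> X \<omega> \<longleftrightarrow> True"
    by (subst distributed_AE2[OF D]) (auto simp: exponential_density_def)
  then show ?thesis by simp
qed

text \<open>Exponential tilting: the weight \<open>exp (- s * x)\<close> turns the density of rate
  \<open>l\<close> into \<open>l / (l + s)\<close> times the density of rate \<open>l + s\<close>,
  which has total mass 1.\<close>

lemma exponential_distributed_Laplace:
  assumes D: "distributed M lborel X (exponential_density l)"
    and l: "0 < l" and s: "0 \<le> s"
  shows "expectation (\<lambda>\<omega>. exp (- s * X \<omega>)) = l / (l + s)"
proof -
  interpret E: prob_space "density lborel (exponential_density (l + s))"
    using l s by (intro prob_space_exponential_density) auto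
  have one: "(\<integral>x. exponential_density (l + s) x \<partial>lborel) = 1"
  proof -
    \<comment> \<open>The factor \<open>1\<close> gives the integrand the product shape of
      \<open>integral_real_density\<close>.\<close>
    have "(\<integral>x. exponential_density (l + s) x * 1 \<partial>lborel)
        = (\<integral>x. 1 \<partial>density lborel (exponential_density (l + s)))"
      using l s by (subst integral_real_density) (auto intro!: AE_I2 exponential_density_nonneg)
    also have "\<dots> = 1"
      using E.prob_space by simp
    finally show ?thesis by simp
  qed
  have "expectation (\<lambda>\<omega>. exp (- s * X \<omega>)) = (\<integral>x. exponential_density l x * exp (- s * x) \<partial>lborel)"
    using l by (intro distributed_integral[OF D, symmetric]) (auto intro: exponential_density_nonneg)
  also have "\<dots> = (\<integral>x. l / (l + s) * exponential_density (l + s) x \<partial>lborel)"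
  proof (intro Bochner_Integration.integral_cong refl)
    fix x
    have "l * exp (- x * l) * exp (- s * x) = l / (l + s) * ((l + s) * exp (- x * (l + s)))"
    proof -
      have "exp (- x * l) * exp (- s * x) = exp (- x * (l + s))"
        by (simp add: algebra_simps flip: exp_add)
      then show ?thesis
        using l s by (simp add: mult.assoc)
    qed
    then show "exponential_density l x * exp (- s * x) = l / (l + s) * exponential_density (l + s) x"
      by (simp add: exponential_density_def)
  qed
  also have "\<dots> = l / (l + s)"
    using one by simp
  finally show ?thesis .
qed

text \<open>The exponential of a sum is a product, and independence takes the expectation inside it.
  Each factor is integrable because it lies in \<open>[0, 1]\<close> almost surely, by
  \<open>0 \<le> s\<close> and nonnegativity of \<open>Y i\<close>.\<close>

lemma exponential_distributed_sum_Laplace: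
  fixes Y :: "'i \<Rightarrow> 'a \<Rightarrow> real"
  assumes I: "finite I"
    and D: "\<And>i. i \<in> I \<Longrightarrow> distributed M lborel (Y i) (exponential_density l)"
    and ind: "indep_vars (\<lambda>_. borel) Y I"
    and l: "0 < l" and s: "0 \<le> s"
  shows "expectation (\<lambda>\<omega>. exp (- s * (\<Sum>i\<in>I. Y i \<omega>))) = (l / (l + s)) ^ card I"
proof -
  have rv: "Y i \<in> borel_measurable M" if "i \<in> I" for i
    using distributed_measurable[OF D[OF that]] by simp
  have ind': "indep_vars (\<lambda>_. borel) (\<lambda>i \<omega>. exp (- s * Y i \<omega>)) I"
    by (rule indep_vars_compose2[OF ind]) auto
  have int: "integrable M (\<lambda>\<omega>. exp (- s * Y i \<omega>))" if "i \<in> I" for i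
  proof (rule integrable_const_bound[where B = 1])
    show "AE \<omega> in M. norm (exp (- s * Y i \<omega>)) \<le> 1"
      using exponential_distributed_AE_nonneg[OF D[OF that]] by eventually_elim (use s in auto)
    show "(\<lambda>\<omega>. exp (- s * Y i \<omega>)) \<in> borel_measurable M"
      using rv[OF that] by measurable
  qed
  have "expectation (\<lambda>\<omega>. exp (- s * (\<Sum>i\<in>I. Y i \<omega>))) = expectation (\<lambda>\<omega>. \<Prod>i\<in>I. exp (- s * Y i \<omega>))"
    by (simp only: sum_distrib_left exp_sum[OF I])
  also have "\<dots> = (\<Prod>i\<in>I. expectation (\<lambda>\<omega>. exp (- s * Y i \<omega>)))"
    by (rule indep_vars_lebesgue_integral[OF I ind' int])
  also have "\<dots> = (\<Prod>i\<in>I. l / (l + s))"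
    using exponential_distributed_Laplace[OF D l s] by (intro prod.cong) auto
  finally show ?thesis by simp
qed

text \<open>A maximum over a finite nonempty set is at most \<open>t\<close> exactly when every
  entry is, so independence makes the probability a product of exponential distribution
  functions.\<close>

lemma exponential_distributed_Max_le:
  fixes X :: "'i \<Rightarrow> 'a \<Rightarrow> real"
  assumes I: "finite I" "I \<noteq> {}"
    and D: "\<And>i. i \<in> I \<Longrightarrow> distributed M lborel (X i) (exponential_density l)"
    and ind: "indep_vars (\<lambda>_. borel) X I"
    and l: "0 < l" and t: "0 \<le> t"
  shows "prob {\<omega> \<in> space M. (MAX i\<in>I. X i \<omega>) \<le> t} = (1 - exp (- t * l)) ^ card I"
proof -
  have "{\<omega> \<in> space M. (MAX i\<in>I. X i \<omega>) \<le> t} = (\<Inter>i\<in>I. X i -` {..t} \<inter> space M)"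
    using I by auto
  then have "prob {\<omega> \<in> space M. (MAX i\<in>I. X i \<omega>) \<le> t} = (\<Prod>i\<in>I. prob (X i -` {..t} \<inter> space M))"
    using indep_varsD_finite[OF ind I(2,1), of "\<lambda>_. {..t}"] by simp
  also have "\<dots> = (\<Prod>i\<in>I. 1 - exp (- t * l))"
  proof (intro prod.cong refl)
    fix i assume "i \<in> I"
    have "X i -` {..t} \<inter> space M = {\<omega> \<in> space M. X i \<omega> \<le> t}" by auto
    then show "prob (X i -` {..t} \<inter> space M) = 1 - exp (- t * l)"
      using exponential_distributedD_le[OF D[OF \<open>i \<in> I\<close>] t l] by simp
  qed
  finally show ?thesis by simp
qed

text \<open>Conditioning on \<open>S\<close>: the joint law is a product measure, so by Fubini
  \<open>S\<close> can be frozen at a value \<open>y\<close>, leaving the probability that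
  \<open>V\<close> is at most \<open>g y\<close>. Phrasing this with the \<open>cdf\<close> avoids
  any density for \<open>V\<close> or \<open>S\<close>.\<close>

lemma prob_indep_le_compose:
  fixes V S :: "'a \<Rightarrow> real" and g :: "real \<Rightarrow> real"
  assumes ind: "indep_var borel V borel S" and g[measurable]: "g \<in> borel_measurable borel"
  shows "prob {\<omega> \<in> space M. V \<omega> \<le> g (S \<omega>)}
    = expectation (\<lambda>\<omega>. cdf (distr M borel V) (g (S \<omega>)))"
proof -
  have V[measurable]: "V \<in> borel_measurable M" and S[measurable]: "S \<in> borel_measurable M"
    and eq: "distr M borel V \<Otimes>\<^sub>M distr M borel S = distr M (borel \<Otimes>\<^sub>M borel) (\<lambda>\<omega>. (V \<omega>, S \<omega>))"
    using ind by (auto simp: indep_var_distribution_eq)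
  interpret DV: prob_space "distr M borel V" by (rule prob_space_distr) fact
  interpret DS: prob_space "distr M borel S" by (rule prob_space_distr) fact
  interpret DV: real_distribution "distr M borel V" by (rule real_distribution_distr) fact
  interpret pair_sigma_finite "distr M borel V" "distr M borel S" ..
  let ?A = "{p :: real \<times> real. fst p \<le> g (snd p)}"
  note DV.borel_measurable_cdf[measurable]
  have A: "?A \<in> sets (borel \<Otimes>\<^sub>M borel)"
  proof -
    have "{p \<in> space (borel \<Otimes>\<^sub>M borel). fst p \<le> g (snd p)} \<in> sets (borel \<Otimes>\<^sub>M borel)"
      by measurable
    then show ?thesis by (simp add: space_pair_measure)
  qed
  have "emeasure M {\<omega> \<in> space M. V \<omega> \<le> g (S \<omega>)}
      = emeasure (distr M (borel \<Otimes>\<^sub>M borel) (\<lambda>\<omega>. (V \<omega>, S \<omega>))) ?A"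
    using A by (subst emeasure_distr) (auto intro!: arg_cong[where f = "emeasure M"])
  also have "\<dots> = (\<integral>\<^sup>+ y. emeasure (distr M borel V) ((\<lambda>x. (x, y)) -` ?A) \<partial>distr M borel S)"
    unfolding eq[symmetric] using A
    by (intro emeasure_pair_measure_alt2) (simp cong: sets_pair_measure_cong)
  \<comment> \<open>The section of \<open>?A\<close> at height \<open>y\<close> is the half-line
    \<open>{..g y}\<close>.\<close>
  also have "\<dots> = (\<integral>\<^sup>+ y. ennreal (cdf (distr M borel V) (g y)) \<partial>distr M borel S)"
    by (intro nn_integral_cong) (simp add: vimage_def cdf_def atMost_def DV.emeasure_eq_measure)
  also have "\<dots> = (\<integral>\<^sup>+ \<omega>. ennreal (cdf (distr M borel V) (g (S \<omega>))) \<partial>M)"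
    by (rule nn_integral_distr) auto
  also have "\<dots> = ennreal (expectation (\<lambda>\<omega>. cdf (distr M borel V) (g (S \<omega>))))"
    by (intro nn_integral_eq_integral integrable_const_bound[where B = 1])
       (auto simp: DV.cdf_nonneg DV.cdf_bounded_prob)
  finally show ?thesis
    by (simp add: emeasure_eq_measure DV.cdf_nonneg integral_nonneg)
qed

end

theorem theorem4:
  fixes P :: "'w measure"
    and M k :: nat
    and W :: "nat \<Rightarrow> real"
    and snr \<gamma>th :: real
    and X Y :: "nat \<Rightarrow> 'w \<Rightarrow> real"
  assumes "M \<ge> 1"
    and "k \<in> {1..M}"
    and "W k > 0"
    and "snr > 0"
    and "\<gamma>th > 0"
    and "edof_model P M k (edof (W k)) X Y"
  shows "fama_outage P M k (edof (W k)) snr \<gamma>th X Y =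
    (\<Sum>j=0..edof (W k). real (edof (W k) choose j) *
       ((-1) ^ j * exp (- (real j * \<gamma>th / snr)) / (1 + real j * \<gamma>th) ^ (M - 1)))"
proof -
  define K where "K = edof (W k)"
  define I where "I = interferers M k"
  define V where "V = X_max K X"
  define S where "S = (\<lambda>\<omega>. \<Sum>j\<in>I. Y j \<omega>)"
  define g where "g = (\<lambda>s. \<gamma>th * (1 / snr + s))"
  note pos = \<open>snr > 0\<close> \<open>\<gamma>th > 0\<close>
  \<comment> \<open>User \<open>k\<close> does not interfere with itself, hence the exponent
    \<open>M - 1\<close> in the result.\<close>
  have I: "finite I" "k \<notin> I" "insert k I = {1..M}" "card I = M - 1"
    using \<open>k \<in> {1..M}\<close> by (auto simp: I_def interferers_def)
  \<comment> \<open>Ensures that the maximum defining \<open>V\<close> ranges over a nonempty index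
    set.\<close>
  have "\<lceil>W k\<rceil> > 0"
    using \<open>W k > 0\<close> by simp
  then have K: "K > 0"
    by (simp add: K_def edof_def)
  interpret prob_space P
    using assms(6) by (simp add: edof_model_def)
  have DX: "distributed P lborel (X i) (exponential_density 1)" if "i \<in> {1..K}" for i
    using assms(6) that by (auto simp: edof_model_def K_def)
  have DY: "distributed P lborel (Y j) (exponential_density 1)" if "j \<in> I" for j
    using assms(6) that by (auto simp: edof_model_def I_def)
  have indX: "indep_vars (\<lambda>_. borel) X {1..K}"
    using assms(6) by (auto simp: edof_model_def K_def)
  have indV: "indep_vars (\<lambda>_. borel) (Y(k := V)) (insert k I)"
    using assms(6) unfolding edof_model_def V_def K_def I(3) by blast
  have "indep_vars (\<lambda>_. borel) (Y(k := V)) I"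
    using indV by (rule indep_vars_subset) auto
  then have indY: "indep_vars (\<lambda>_. borel) Y I"
    using I(2) by (subst indep_vars_cong[where Y = "Y(k := V)" and N' = "\<lambda>_. borel"]) auto
  \<comment> \<open>Since \<open>k\<close> is outside \<open>I\<close>, the update at
    \<open>k\<close> leaves the sum unchanged; \<open>indep_vars_sum\<close> then separates slot
    \<open>k\<close>, which holds \<open>V\<close>, from the total interference.\<close>
  have "(\<lambda>\<omega>. \<Sum>i\<in>I. (Y(k := V)) i \<omega>) = S"
    unfolding S_def using I(2) by (intro ext sum.cong) auto
  with indep_vars_sum[OF I(1,2) indV] have indVS: "indep_var borel V borel S"
    by simp
  then have S[measurable]: "S \<in> borel_measurable P" and V[measurable]: "V \<in> borel_measurable P"
    by (auto dest: indep_var_rv1 indep_var_rv2)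
  have "AE \<omega> in P. \<forall>j\<in>I. 0 \<le> Y j \<omega>"
    using I(1) DY by (subst AE_ball_countable) (auto intro: exponential_distributed_AE_nonneg countable_finite)
  then have Snn: "AE \<omega> in P. 0 \<le> S \<omega>"
    by eventually_elim (auto simp: S_def sum_nonneg)
  \<comment> \<open>Nonnegative arguments suffice, since \<open>g (S \<omega>)\<close> is
    nonnegative almost surely.\<close>
  have cdfV: "cdf (distr P borel V) t = (1 - exp (- t)) ^ K" if "0 \<le> t" for t
  proof -
    have "cdf (distr P borel V) t = prob {\<omega> \<in> space P. V \<omega> \<le> t}"
      unfolding cdf_def by (subst measure_distr) (auto intro!: arg_cong[where f = prob])
    also have "\<dots> = (1 - exp (- t)) ^ K"
      using exponential_distributed_Max_le[of "{1..K}" X 1 t] K DX indX that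
      by (simp add: V_def X_max_def)
    finally show ?thesis .
  qed
  \<comment> \<open>Each power of \<open>exp (- g s)\<close> splits into a deterministic noise
    factor and a factor \<open>exp (- (real j * \<gamma>th) * s)\<close>, whose expectation at
    \<open>s = S \<omega>\<close> is a Laplace transform.\<close>
  have binom: "(1 - exp (- g s)) ^ K =
      (\<Sum>j=0..K. real (K choose j) * ((-1) ^ j * exp (- (real j * \<gamma>th / snr)) * exp (- (real j * \<gamma>th) * s)))"
    for s
  proof -
    have "(1 - exp (- g s)) ^ K = (- exp (- g s) + 1) ^ K" by simp
    also have "\<dots> = (\<Sum>j\<le>K. real (K choose j) * (- exp (- g s)) ^ j * 1 ^ (K - j))"
      by (rule binomial_ring)
    also have "\<dots> = (\<Sum>j=0..K. real (K choose j) *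
        ((-1) ^ j * exp (- (real j * \<gamma>th / snr)) * exp (- (real j * \<gamma>th) * s)))"
    proof (intro sum.cong)
      fix j
      have "(- exp (- g s)) ^ j = (-1) ^ j * exp (real j * - g s)"
        by (simp add: power_minus[of "exp (- g s)"] flip: exp_of_nat_mult)
      also have "real j * - g s = - (real j * \<gamma>th / snr) + - (real j * \<gamma>th) * s"
        by (simp add: g_def algebra_simps)
      finally show "real (K choose j) * (- exp (- g s)) ^ j * 1 ^ (K - j) = real (K choose j) *
        ((-1) ^ j * exp (- (real j * \<gamma>th / snr)) * exp (- (real j * \<gamma>th) * s))"
        by (simp only: exp_add) (simp add: mult.assoc)
    qed auto
    finally show ?thesis .
  qed
  have int: "integrable P (\<lambda>\<omega>. exp (- (real j * \<gamma>th) * S \<omega>))" for j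
    using Snn pos by (intro integrable_const_bound[where B = 1]) (auto elim!: eventually_mono)
  have sinr: "fama_sinr M k K snr X Y = (\<lambda>\<omega>. snr * V \<omega> / (1 + snr * S \<omega>))"
    by (simp add: fun_eq_iff fama_sinr_def I_def V_def S_def)
  have "fama_outage P M k K snr \<gamma>th X Y = prob {\<omega> \<in> space P. V \<omega> \<le> g (S \<omega>)}"
    unfolding fama_outage_def
  \<comment> \<open>The two events need agree only almost surely: clearing the denominator
    \<open>1 + snr * S \<omega>\<close> requires it to be positive, which is known where
    \<open>0 \<le> S \<omega>\<close>.\<close>
  proof (rule finite_measure_eq_AE)
    show "AE \<omega> in P. \<omega> \<in> {\<omega> \<in> space P. fama_sinr M k K snr X Y \<omega> \<le> \<gamma>th}
        \<longleftrightarrow> \<omega> \<in> {\<omega> \<in> space P. V \<omega> \<le> g (S \<omega>)}"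
      using Snn
    proof eventually_elim
      case (elim \<omega>)
      then have "1 + snr * S \<omega> > 0" using pos by (simp add: add_pos_nonneg)
      then show ?case
        using pos by (simp add: sinr g_def field_simps)
    qed
    show "{\<omega> \<in> space P. fama_sinr M k K snr X Y \<omega> \<le> \<gamma>th} \<in> events"
      unfolding sinr by measurable
    show "{\<omega> \<in> space P. V \<omega> \<le> g (S \<omega>)} \<in> events"
      unfolding g_def by measurable
  qed
  also have "\<dots> = expectation (\<lambda>\<omega>. cdf (distr P borel V) (g (S \<omega>)))"
    using indVS by (rule prob_indep_le_compose) (simp add: g_def)
  also have "\<dots> = expectation (\<lambda>\<omega>. (1 - exp (- g (S \<omega>))) ^ K)"
  proof (rule integral_cong_AE)
    show "AE \<omega> in P. cdf (distr P borel V) (g (S \<omega>)) = (1 - exp (- g (S \<omega>))) ^ K"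
      using Snn by eventually_elim (use pos in \<open>simp add: cdfV g_def\<close>)
    interpret DV: real_distribution "distr P borel V" by (rule real_distribution_distr) fact
    note DV.borel_measurable_cdf[measurable]
    show "(\<lambda>\<omega>. cdf (distr P borel V) (g (S \<omega>))) \<in> borel_measurable P"
      unfolding g_def by measurable
  qed (simp add: g_def)
  also have "\<dots> = (\<Sum>j=0..K. real (K choose j) * ((-1) ^ j * exp (- (real j * \<gamma>th / snr)) *
      expectation (\<lambda>\<omega>. exp (- (real j * \<gamma>th) * S \<omega>))))"
    \<comment> \<open>Linearity of expectation over the finite sum, justified by integrability of
      each exponential.\<close>
    unfolding binom using int by (subst Bochner_Integration.integral_sum) simp_all
  also have "\<dots> = (\<Sum>j=0..K. real (K choose j) *
       ((-1) ^ j * exp (- (real j * \<gamma>th / snr)) / (1 + real j * \<gamma>th) ^ (M - 1)))"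
  proof (intro sum.cong refl)
    fix j
    \<comment> \<open>The Laplace transform with rate \<open>1\<close>, evaluated at
      \<open>real j * \<gamma>th\<close>; for \<open>j = 0\<close> both sides are 1.\<close>
    have "expectation (\<lambda>\<omega>. exp (- (real j * \<gamma>th) * S \<omega>)) = 1 / (1 + real j * \<gamma>th) ^ (M - 1)"
      using exponential_distributed_sum_Laplace[OF I(1) DY indY, of "real j * \<gamma>th"] pos
      by (simp add: S_def I(4) power_divide)
    then show "real (K choose j) * ((-1) ^ j * exp (- (real j * \<gamma>th / snr)) *
        expectation (\<lambda>\<omega>. exp (- (real j * \<gamma>th) * S \<omega>))) = real (K choose j) *
        ((-1) ^ j * exp (- (real j * \<gamma>th / snr)) / (1 + real j * \<gamma>th) ^ (M - 1))"
      by simp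
  qed
  finally show ?thesis
    unfolding K_def .
qed

end
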